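(* For every integer $n\ge 3$ there exists a degenerated magic polygon $D(n,2)$.
   Context: Degenerated magic polygon $D(n,2)$: take two regular $n$-gons of distinct sizes sharing a common vertex $C$ (the root vertex), nested so that they are homothetic with center $C$. On each of the $n-2$ edges of each polygon not adjacent to $C$ there is one intermediate point besides the two end vertices. Let $V_1,\dots,V_{n-1}$ (resp. $V_1^{\ast},\dots,V_{n-1}^{\ast}$) be the vertices other than $C$ of the larger (resp. smaller) polygon in clockwise order, and let $M_j$ (resp. $M_j^{\ast}$), $1\le j\le n-2$, be the intermediate point between $V_j$ and $V_{j+1}$ (resp. $V_j^{\ast}$ and $V_{j+1}^{\ast}$), where $M_j^{\ast}$ lies on the segment $CM_j$. Together with $C$ there are $4(n-2)+3=4n-5$ points. A degenerated magic polygon $D(n,2)$ is a labeling of these points by the integers $1,2,\dots,4n-5$, each used exactly once, with labels $z_j,z_j^{\ast},m_j,m_j^{\ast},c$ of $V_j,V_j^{\ast},M_j,M_j^{\ast},C$ respectively, such that for some fixed value $u$ (the magic sum): $z_j+m_j+z_{j+1}=u$ and $z_j^{\ast}+m_j^{\ast}+z_{j+1}^{\ast}=u$ for $1\le j\le n-2$; $z_j+z_j^{\ast}+c=u$ for $1\le j\le n-1$; and $m_j+m_j^{\ast}+c=u$ for $1\le j\le n-2$. *)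

theory Defs
  imports "HOL-Analysis.Analysis"
begin

text \<open>The plane is the type of complex numbers. The factor \<open>w\<close> combines the circumradius
  with the rotation of the polygon; the minus sign makes the order clockwise.\<close>

definition regular_polygon_cw :: "nat \<Rightarrow> (nat \<Rightarrow> complex) \<Rightarrow> bool" where
  "regular_polygon_cw n V \<longleftrightarrow>
     n \<ge> 3 \<and> (\<exists>a w. w \<noteq> 0 \<and> (\<forall>k<n. V k = a + w * cis (- (2 * pi * real k / real n))))"

text \<open>\<open>V\<close>, \<open>M\<close> belong to the larger polygon and \<open>V'\<close>, \<open>M'\<close> to the smaller one.
  Index 0 of \<open>V\<close> and of \<open>V'\<close> is the common root vertex, so the vertices other than the root
  are those with indices 1 to n - 1, and the edges not adjacent to the root
  join the vertices j and j + 1 for j from 1 to n - 2. Values at other indices are irrelevant.\<close>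

definition degenerated_figure ::
  "nat \<Rightarrow> complex \<Rightarrow> (nat \<Rightarrow> complex) \<Rightarrow> (nat \<Rightarrow> complex) \<Rightarrow>
   (nat \<Rightarrow> complex) \<Rightarrow> (nat \<Rightarrow> complex) \<Rightarrow> bool" where
  "degenerated_figure n C V V' M M' \<longleftrightarrow>
     regular_polygon_cw n V \<and> regular_polygon_cw n V' \<and> V 0 = C \<and> V' 0 = C \<and>
     (\<exists>r::real. 0 < r \<and> r < 1 \<and> (\<forall>k<n. V' k = C + of_real r * (V k - C))) \<and>
     (\<forall>j\<in>{1..n-2}. M j \<in> open_segment (V j) (V (j + 1)) \<and>
                     M' j \<in> open_segment (V' j) (V' (j + 1)) \<and>
                     M' j \<in> closed_segment C (M j))"

definition figure_points ::
  "nat \<Rightarrow> complex \<Rightarrow> (nat \<Rightarrow> complex) \<Rightarrow> (nat \<Rightarrow> complex) \<Rightarrow>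
   (nat \<Rightarrow> complex) \<Rightarrow> (nat \<Rightarrow> complex) \<Rightarrow> complex set" where
  "figure_points n C V V' M M' =
     {C} \<union> V ` {1..n-1} \<union> V' ` {1..n-1} \<union> M ` {1..n-2} \<union> M' ` {1..n-2}"

definition degenerated_magic_polygon ::
  "nat \<Rightarrow> complex \<Rightarrow> (nat \<Rightarrow> complex) \<Rightarrow> (nat \<Rightarrow> complex) \<Rightarrow>
   (nat \<Rightarrow> complex) \<Rightarrow> (nat \<Rightarrow> complex) \<Rightarrow> (complex \<Rightarrow> nat) \<Rightarrow> bool" where
  "degenerated_magic_polygon n C V V' M M' l \<longleftrightarrow>
     degenerated_figure n C V V' M M' \<and>
     bij_betw l (figure_points n C V V' M M') {1..4*n-5} \<and>
     (\<exists>u. (\<forall>j\<in>{1..n-2}. l (V j) + l (M j) + l (V (j + 1)) = u \<and>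
                          l (V' j) + l (M' j) + l (V' (j + 1)) = u) \<and>
          (\<forall>j\<in>{1..n-1}. l (V j) + l (V' j) + l C = u) \<and>
          (\<forall>j\<in>{1..n-2}. l (M j) + l (M' j) + l C = u))"

end

theory Submission
  imports Defs
begin

text \<open>Each of the \<open>2 * n - 3\<close> rays from the root \<open>C\<close> carries two further points, whose labels have
  the same sum \<open>s = u - c\<close> on every ray. Adding the equations of an edge and of its smaller
  copy gives \<open>3 * s = 2 * u\<close>, so \<open>s = 2 * c\<close> and \<open>u = 3 * c\<close>; summing all labels then forces
  \<open>c = 2 * n - 2\<close>, the median label. In terms of the offset of a label from \<open>c\<close> all magic sums
  become zero: opposite offsets sit on each ray, and the offsets along the path
  \<open>V\<^sub>1, M\<^sub>1, V\<^sub>2, \<dots>, V\<^sub>n\<^sub>-\<^sub>1\<close> must have absolute values \<open>1, \<dots>, 2 * n - 3\<close> in some order, with the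
  offset of \<open>M\<^sub>j\<close> equal to minus the sum of those of \<open>V\<^sub>j\<close> and \<open>V\<^sub>j\<^sub>+\<^sub>1\<close>.

  With alternating signs at the vertices, the absolute values at the intermediate points are
  differences of neighbouring absolute values, so a doubled graceful labelling of the path solves
  the problem: the vertices get \<open>1, -(2n-3), 3, -(2n-5), 5, \<dots>\<close>, whose absolute values are the
  odd numbers, and the intermediate points get the even numbers \<open>2n-4, 2n-6, \<dots>, 2\<close>
  (\<open>path_offset_abs_inj\<close>, \<open>path_offset_edge\<close>).

  For the labels to be a function of the points, the points must be pairwise distinct. The root is
  put at the origin, with midpoints as intermediate points and homothety ratio \<open>1/2\<close>. All
  non-root points then lie in the open left half plane, and the slope \<open>Im z / Re z\<close> strictly
  decreases along the path, so distinct rays do not meet away from the root (\<open>inj_on_point\<close>).\<close>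

section \<open>Rays through the root vertex\<close>

definition vertex :: "nat \<Rightarrow> nat \<Rightarrow> complex" where
  "vertex n k = cis (- (2 * pi * real k / real n)) - 1"

text \<open>The larger polygon traversed as a path: vertices other than the root at odd indices
  \<open>1, 3, \<dots>, 2 * n - 3\<close>, midpoints at the even indices in between.\<close>

definition ray_point :: "nat \<Rightarrow> nat \<Rightarrow> complex" where
  "ray_point n i =
     (if odd i then vertex n ((i + 1) div 2)
      else midpoint (vertex n (i div 2)) (vertex n (i div 2 + 1)))"

definition slope :: "complex \<Rightarrow> real" where
  "slope z = Im z / Re z"

text \<open>The inscribed angle theorem: seen from the root, the vertices lie in the directions
  \<open>-\<i> * cis (- t)\<close> with \<open>t\<close> half of the central angle. Hence their slopes are the values \<open>cot t\<close>,
  and \<open>0 < t < pi\<close> for every vertex but the root.\<close>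

lemma vertex_polar:
  assumes "n > 0"
  shows "vertex n k = of_real (2 * sin (pi * real k / real n)) *
           Complex (- sin (pi * real k / real n)) (- cos (pi * real k / real n))"
proof -
  define t where "t = pi * real k / real n"
  have "vertex n k = cis (- (2 * t)) - 1"
    by (simp add: vertex_def t_def mult.assoc)
  also have "\<dots> = of_real (2 * sin t) * Complex (- sin t) (- cos t)"
    by (simp add: complex_eq_iff cos_double_sin sin_double power2_eq_square)
  finally show ?thesis by (simp add: t_def)
qed

lemma sin_ray_angle_pos:
  assumes "0 < k" "k < n"
  shows "sin (pi * real k / real n) > 0"
  using assms by (intro sin_gt_zero) (auto simp: field_simps)

lemma Re_vertex_neg:
  assumes "0 < k" "k < n"
  shows "Re (vertex n k) < 0"
  using sin_ray_angle_pos[OF assms] assms by (simp add: vertex_polar)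

lemma slope_vertex:
  assumes "0 < k" "k < n"
  shows "slope (vertex n k) = cot (pi * real k / real n)"
  using sin_ray_angle_pos[OF assms] assms by (simp add: vertex_polar slope_def cot_def)

lemma slope_vertex_Suc:
  assumes "0 < k" "k + 1 < n"
  shows "slope (vertex n (k + 1)) < slope (vertex n k)"
proof -
  define s where "s = pi * real k / real n"
  define t where "t = pi * real (k + 1) / real n"
  have pos: "sin s > 0" "sin t > 0"
    unfolding s_def t_def by (rule sin_ray_angle_pos; use assms in simp)+
  have "sin (t - s) > 0"
  proof -
    have "t - s = pi * real 1 / real n"
      by (simp add: s_def t_def distrib_left add_divide_distrib)
    thus ?thesis using sin_ray_angle_pos[of 1 n] assms by simp
  qed
  hence "cos t * sin s < cos s * sin t"
    by (simp add: sin_diff mult.commute)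
  hence "cot t < cot s"
    using pos by (simp add: cot_def field_simps)
  thus ?thesis using assms by (simp add: slope_vertex s_def t_def)
qed

text \<open>The slope of the midpoint is the mediant of two fractions whose denominators have
  the same sign.\<close>

lemma slope_midpoint:
  assumes "Re a < 0" "Re b < 0" "slope b < slope a"
  shows "slope b < slope (midpoint a b)" "slope (midpoint a b) < slope a"
proof -
  have cross: "Im b * Re a < Im a * Re b"
    using assms by (simp add: slope_def field_simps)
  have mid: "Im (midpoint a b) = (Im a + Im b) / 2" "Re (midpoint a b) = (Re a + Re b) / 2"
    by (simp_all add: midpoint_def)
  show "slope b < slope (midpoint a b)" "slope (midpoint a b) < slope a"
    unfolding slope_def mid using assms(1,2) cross by (simp_all add: field_simps)
qed

lemma Re_ray_point_neg:
  assumes "0 < i" "i < 2 * n - 2"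
  shows "Re (ray_point n i) < 0"
proof (cases "odd i")
  case True
  then have "0 < (i + 1) div 2" "(i + 1) div 2 < n" using assms by presburger+
  thus ?thesis using True by (simp add: ray_point_def Re_vertex_neg)
next
  case False
  then have "0 < i div 2" "i div 2 + 1 < n" using assms by presburger+
  hence "Re (vertex n (i div 2)) < 0" "Re (vertex n (i div 2 + 1)) < 0"
    by (simp_all add: Re_vertex_neg)
  thus ?thesis using False by (simp add: ray_point_def midpoint_def)
qed

lemma slope_ray_point_Suc:
  assumes "0 < i" "i + 1 < 2 * n - 2"
  shows "slope (ray_point n (i + 1)) < slope (ray_point n i)"
proof (cases "odd i")
  case True
  then obtain k where i: "i = 2 * k + 1" by (elim oddE)
  have k: "0 < k + 1" "k + 1 + 1 < n" using assms i by auto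
  show ?thesis
    using slope_midpoint(2)[OF Re_vertex_neg Re_vertex_neg slope_vertex_Suc[OF k]] k
    by (simp add: ray_point_def i)
next
  case False
  then obtain k where i: "i = 2 * k" by (auto elim: evenE)
  have k: "0 < k" "k + 1 < n" using assms i by auto
  show ?thesis
    using slope_midpoint(1)[OF Re_vertex_neg Re_vertex_neg slope_vertex_Suc[OF k]] k
    by (simp add: ray_point_def i)
qed

lemma slope_ray_point_less:
  assumes "0 < i" "i < j" "j < 2 * n - 2"
  shows "slope (ray_point n j) < slope (ray_point n i)"
  using assms(2,3)
proof (induction j)
  case 0
  then show ?case by simp
next
  case (Suc j)
  have "slope (ray_point n (Suc j)) < slope (ray_point n j)"
    using slope_ray_point_Suc[of j n] Suc.prems assms(1) by simp
  thus ?case using Suc by (cases "i = j") auto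
qed

section \<open>The points of the figure\<close>

definition indices :: "nat \<Rightarrow> int set" where
  "indices n = {- (2 * int n - 3) .. 2 * int n - 3}"

text \<open>A positive index is a point of the larger polygon, and its negation is the copy of that
  point under the homothety with centre 0 and ratio \<open>1/2\<close>. This matches the
  symmetry \<open>offset n (- i) = - offset n i\<close> of the labels.\<close>

definition point :: "nat \<Rightarrow> int \<Rightarrow> complex" where
  "point n i =
     of_real (if i = 0 then 0 else if i > 0 then 1 else 1 / 2) * ray_point n (nat \<bar>i\<bar>)"

text \<open>Scaling by a positive real keeps the slope, so the slope recovers the ray. The two points of a
  ray differ because one is half of the other and neither is zero.\<close>

lemma inj_on_point:
  assumes "n \<ge> 2"
  shows "inj_on (point n) (indices n)"
proof (rule inj_onI)
  fix i j assume ij: "i \<in> indices n" "j \<in> indices n" and eq: "point n i = point n j"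
  have neg: "Re (ray_point n (nat \<bar>k\<bar>)) < 0" if "k \<in> indices n" "k \<noteq> 0" for k
    using that by (intro Re_ray_point_neg) (auto simp: indices_def)
  have zero: "point n k = 0 \<longleftrightarrow> k = 0" if "k \<in> indices n" for k
    using neg[OF that] by (auto simp: point_def complex_eq_iff)
  show "i = j"
  proof (cases "i = 0 \<or> j = 0")
    case True
    thus ?thesis using zero ij eq by metis
  next
    case False
    have "slope (ray_point n (nat \<bar>k\<bar>)) = slope (point n k)" if "k \<noteq> 0" for k
      using that by (auto simp: slope_def point_def)
    hence "slope (ray_point n (nat \<bar>i\<bar>)) = slope (ray_point n (nat \<bar>j\<bar>))"
      using False eq by simp
    moreover have "0 < nat \<bar>k\<bar>" "nat \<bar>k\<bar> < 2 * n - 2" if "k \<in> indices n" "k \<noteq> 0" for k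
      using that by (auto simp: indices_def)
    ultimately have "nat \<bar>i\<bar> = nat \<bar>j\<bar>"
      using slope_ray_point_less ij False by (metis less_irrefl linorder_neqE_nat)
    hence abs: "\<bar>i\<bar> = \<bar>j\<bar>" by simp
    have "i > 0 \<longleftrightarrow> j > 0"
      using eq abs neg[OF ij(1)] False
      by (auto simp: point_def complex_eq_iff split: if_splits)
    thus ?thesis using abs by linarith
  qed
qed

lemma vertex_0 [simp]: "vertex n 0 = 0"
  by (simp add: vertex_def)

lemma point_0 [simp]: "point n 0 = 0"
  by (simp add: point_def)

lemma vertex_eq_point:
  assumes "j \<ge> 1"
  shows "vertex n j = point n (2 * int j - 1)" "vertex n j / 2 = point n (- (2 * int j - 1))"
proof -
  have "nat \<bar>2 * int j - 1\<bar> = 2 * j - 1" "nat \<bar>1 - 2 * int j\<bar> = 2 * j - 1"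
    using assms by auto
  thus "vertex n j = point n (2 * int j - 1)" "vertex n j / 2 = point n (- (2 * int j - 1))"
    using assms by (auto simp: point_def ray_point_def)
qed

lemma midpoint_eq_point:
  assumes "j \<ge> 1"
  shows "midpoint (vertex n j) (vertex n (j + 1)) = point n (2 * int j)"
    "midpoint (vertex n j) (vertex n (j + 1)) / 2 = point n (- (2 * int j))"
  using assms by (auto simp: point_def ray_point_def nat_mult_distrib)

lemma degenerated_figure_vertex:
  assumes "n \<ge> 3"
  shows "degenerated_figure n 0 (vertex n) (\<lambda>k. vertex n k / 2)
    (\<lambda>j. midpoint (vertex n j) (vertex n (j + 1)))
    (\<lambda>j. midpoint (vertex n j) (vertex n (j + 1)) / 2)"
proof -
  have neq: "vertex n j \<noteq> vertex n (j + 1)" if "j \<in> {1..n-2}" for j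
    using slope_vertex_Suc[of j n] that assms by force
  have half: "midpoint a b / 2 = midpoint (a / 2) (b / 2)" for a b :: complex
    by (simp add: midpoint_def complex_eq_iff add_divide_distrib)
  have "midpoint a b / 2 = midpoint 0 (midpoint a b)" for a b :: complex
    by (simp add: midpoint_def complex_eq_iff)
  hence ray: "midpoint a b / 2 \<in> closed_segment 0 (midpoint a b)" for a b :: complex
    by (metis midpoint_in_closed_segment)
  have "regular_polygon_cw n (vertex n)"
    unfolding regular_polygon_cw_def using assms
    by (intro conjI exI[of _ "-1"] exI[of _ 1]) (auto simp: vertex_def)
  moreover have "regular_polygon_cw n (\<lambda>k. vertex n k / 2)"
    unfolding regular_polygon_cw_def using assms
    by (intro conjI exI[of _ "-1/2"] exI[of _ "1/2"]) (auto simp: vertex_def field_simps)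
  moreover have "midpoint (vertex n j) (vertex n (j + 1)) / 2
      \<in> open_segment (vertex n j / 2) (vertex n (j + 1) / 2)" if "j \<in> {1..n-2}" for j
    unfolding half midpoint_in_open_segment using neq[OF that] by simp
  moreover have "\<exists>r::real. 0 < r \<and> r < 1 \<and>
      (\<forall>k<n. vertex n k / 2 = 0 + of_real r * (vertex n k - 0))"
    by (intro exI[of _ "1/2"]) simp
  ultimately show ?thesis
    using neq ray unfolding degenerated_figure_def by simp
qed

lemma figure_points_vertex:
  assumes "n \<ge> 3"
  shows "figure_points n 0 (vertex n) (\<lambda>k. vertex n k / 2)
    (\<lambda>j. midpoint (vertex n j) (vertex n (j + 1)))
    (\<lambda>j. midpoint (vertex n j) (vertex n (j + 1)) / 2) = point n ` indices n"
proof -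
  have "indices n = {0} \<union> (\<lambda>j. 2 * int j - 1) ` {1..n-1} \<union> (\<lambda>j. - (2 * int j - 1)) ` {1..n-1}
      \<union> (\<lambda>j. 2 * int j) ` {1..n-2} \<union> (\<lambda>j. - (2 * int j)) ` {1..n-2}" (is "_ = ?U")
  proof
    show "?U \<subseteq> indices n" using assms by (auto simp: indices_def)
    show "indices n \<subseteq> ?U"
    proof
      fix i assume i: "i \<in> indices n"
      define j where "j = nat ((\<bar>i\<bar> + 1) div 2)"
      have j: "int j = (\<bar>i\<bar> + 1) div 2" by (simp add: j_def)
      hence "i = 0 \<or> \<bar>i\<bar> = 2 * int j - 1 \<and> int j \<ge> 1 \<or> \<bar>i\<bar> = 2 * int j \<and> int j \<ge> 1"
        by presburger
      moreover have "\<bar>i\<bar> \<le> 2 * int n - 3" using i by (auto simp: indices_def)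
      ultimately consider "i = 0"
        | "i = 2 * int j - 1" "j \<in> {1..n-1}" | "i = - (2 * int j - 1)" "j \<in> {1..n-1}"
        | "i = 2 * int j" "j \<in> {1..n-2}" | "i = - (2 * int j)" "j \<in> {1..n-2}"
        using assms by (cases "i \<ge> 0") force+
      thus "i \<in> ?U" by cases blast+
    qed
  qed
  moreover have "vertex n ` {1..n-1} = point n ` (\<lambda>j. 2 * int j - 1) ` {1..n-1}"
    "(\<lambda>k. vertex n k / 2) ` {1..n-1} = point n ` (\<lambda>j. - (2 * int j - 1)) ` {1..n-1}"
    unfolding image_image by (intro image_cong refl; use vertex_eq_point in force)+
  moreover have "(\<lambda>j. midpoint (vertex n j) (vertex n (j + 1))) ` {1..n-2} =
      point n ` (\<lambda>j. 2 * int j) ` {1..n-2}"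
    "(\<lambda>j. midpoint (vertex n j) (vertex n (j + 1)) / 2) ` {1..n-2} =
      point n ` (\<lambda>j. - (2 * int j)) ` {1..n-2}"
    unfolding image_image by (intro image_cong refl; use midpoint_eq_point in force)+
  ultimately show ?thesis
    unfolding figure_points_def by (simp only: image_Un image_insert image_empty point_0)
qed

section \<open>The labels\<close>

text \<open>Odd indices belong to vertices. The vertex with number \<open>k = (i + 1) div 2\<close> gets \<open>k\<close> when \<open>k\<close> is
  odd, and \<open>k - (2 * n - 1)\<close>, which is odd and negative, when \<open>k\<close> is even. Two neighbouring vertices
  \<open>k, k + 1\<close> have sum \<open>2 * k - (2 * n - 2)\<close> for either parity of \<open>k\<close>, so one formula serves all
  even indices.\<close>

definition path_offset :: "nat \<Rightarrow> int \<Rightarrow> int" where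
  "path_offset n i =
     (if even i then 2 * int n - 2 - i
      else if odd ((i + 1) div 2) then (i + 1) div 2
      else (i + 1) div 2 - (2 * int n - 1))"

definition offset :: "nat \<Rightarrow> int \<Rightarrow> int" where
  "offset n i = sgn i * path_offset n \<bar>i\<bar>"

lemma offset_simps:
  assumes "i > 0"
  shows "offset n i = path_offset n i" "offset n (- i) = - path_offset n i"
  using assms by (simp_all add: offset_def)

lemma offset_0 [simp]: "offset n 0 = 0"
  by (simp add: offset_def)

lemma path_offset_simps:
  "path_offset n (2 * q) = 2 * int n - 2 - 2 * q"
  "path_offset n (4 * q + 1) = 2 * q + 1"
  "path_offset n (4 * q + 3) = - (2 * int n - 3 - 2 * q)"
proof -
  have "(4 * q + 1 + 1) div 2 = 2 * q + 1" "(4 * q + 3 + 1) div 2 = 2 * q + 2"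
    by presburger+
  thus "path_offset n (2 * q) = 2 * int n - 2 - 2 * q"
    "path_offset n (4 * q + 1) = 2 * q + 1"
    "path_offset n (4 * q + 3) = - (2 * int n - 3 - 2 * q)"
    by (simp_all add: path_offset_def)
qed

lemma mod_4_cases:
  fixes i :: int
  obtains q where "i = 2 * q" | q where "i = 4 * q + 1" | q where "i = 4 * q + 3"
proof -
  have "i = 2 * (i div 2) \<or> i = 4 * (i div 4) + 1 \<or> i = 4 * (i div 4) + 3" by presburger
  thus ?thesis using that by blast
qed

text \<open>The absolute value determines the index: its parity separates midpoints from vertices, and
  the two linear expressions for vertices have values at most \<open>n - 1\<close> and at least \<open>n\<close>,
  respectively, since \<open>i \<le> 2 * n - 3\<close>.\<close>

lemma path_offset_abs_cases:
  assumes "0 < i" "i \<le> 2 * int n - 3"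
  defines "a \<equiv> \<bar>path_offset n i\<bar>"
  shows "even a \<and> a = 2 * int n - 2 - i \<or> odd a \<and> 2 * a = i + 1 \<or> odd a \<and> 2 * a = 4 * int n - 3 - i"
proof (cases i rule: mod_4_cases)
  case (1 q)
  have "a = 2 * int n - 2 - 2 * q"
    unfolding a_def 1 path_offset_simps using assms(2) 1 by linarith
  thus ?thesis using 1 by simp
next
  case (2 q)
  have "a = 2 * q + 1"
    unfolding a_def 2 path_offset_simps using assms(1) 2 by linarith
  thus ?thesis using 2 by simp
next
  case (3 q)
  have "a = 2 * int n - 3 - 2 * q"
    unfolding a_def 3 path_offset_simps using assms(2) 3 by linarith
  thus ?thesis using 3 by simp
qed

lemma path_offset_range:
  assumes "0 < i" "i \<le> 2 * int n - 3"
  shows "path_offset n i \<noteq> 0" "\<bar>path_offset n i\<bar> \<le> 2 * int n - 3"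
proof -
  note abs_cases = path_offset_abs_cases[OF assms]
  have "0 < \<bar>path_offset n i\<bar>" using abs_cases assms by linarith
  thus "path_offset n i \<noteq> 0" by simp
  \<comment> \<open>The last linear expression alone only gives the bound \<open>2 * n - 2\<close>; parity excludes equality.\<close>
  have "\<bar>path_offset n i\<bar> \<le> 2 * int n - 2" using abs_cases assms by linarith
  moreover have "\<bar>path_offset n i\<bar> \<noteq> 2 * int n - 2"
  proof
    assume eq: "\<bar>path_offset n i\<bar> = 2 * int n - 2"
    have "even (2 * int n - 2)" by simp
    thus False using abs_cases assms(1) unfolding eq by linarith
  qed
  ultimately show "\<bar>path_offset n i\<bar> \<le> 2 * int n - 3" by linarith
qed

lemma path_offset_abs_inj:
  assumes i: "0 < i" "i \<le> 2 * int n - 3" and j: "0 < j" "j \<le> 2 * int n - 3"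
    and eq: "\<bar>path_offset n i\<bar> = \<bar>path_offset n j\<bar>"
  shows "i = j"
  using path_offset_abs_cases[OF i] path_offset_abs_cases[OF j] i j unfolding eq
  by (elim disjE conjE; (linarith | blast))

lemma path_offset_edge:
  "path_offset n (2 * j - 1) + path_offset n (2 * j) + path_offset n (2 * j + 1) = 0"
proof (cases "even j")
  case True
  then obtain q where j: "j = 2 * q" by (elim evenE)
  have "path_offset n (2 * j - 1) = - (2 * int n - 3 - 2 * (q - 1))"
    using path_offset_simps(3)[of n "q - 1"] by (simp add: j algebra_simps)
  moreover have "path_offset n (2 * j + 1) = 2 * q + 1"
    using path_offset_simps(2)[of n q] by (simp add: j)
  ultimately show ?thesis using path_offset_simps(1)[of n j] j by simp
next
  case False
  then obtain q where j: "j = 2 * q + 1" by (elim oddE)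
  have "path_offset n (2 * j - 1) = 2 * q + 1"
    using path_offset_simps(2)[of n q] by (simp add: j add.commute)
  moreover have "path_offset n (2 * j + 1) = - (2 * int n - 3 - 2 * q)"
    using path_offset_simps(3)[of n q] by (simp add: j add.commute)
  ultimately show ?thesis using path_offset_simps(1)[of n j] j by simp
qed

text \<open>An injection of the finite index set into itself is onto, so the distinct
  absolute values of \<open>path_offset_abs_inj\<close> and the range bound suffice.\<close>

lemma bij_betw_offset: "bij_betw (offset n) (indices n) (indices n)"
proof -
  have abs: "\<bar>offset n i\<bar> = \<bar>path_offset n \<bar>i\<bar>\<bar>" if "i \<noteq> 0" for i
    using that by (simp add: offset_def abs_mult abs_sgn_eq)
  have bounds: "0 < \<bar>i\<bar>" "\<bar>i\<bar> \<le> 2 * int n - 3" if "i \<in> indices n" "i \<noteq> 0" for i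
    using that by (simp_all add: indices_def abs_le_iff)
  have range: "path_offset n \<bar>i\<bar> \<noteq> 0" "\<bar>path_offset n \<bar>i\<bar>\<bar> \<le> 2 * int n - 3"
    if "i \<in> indices n" "i \<noteq> 0" for i
    using path_offset_range[OF bounds[OF that]] by simp_all
  have "offset n ` indices n \<subseteq> indices n"
  proof (rule image_subsetI)
    fix i assume i: "i \<in> indices n"
    show "offset n i \<in> indices n"
    proof (cases "i = 0")
      case False
      hence "\<bar>offset n i\<bar> \<le> 2 * int n - 3" using abs[OF False] range(2)[OF i False] by simp
      thus ?thesis by (simp add: indices_def abs_le_iff)
    qed (use i in simp)
  qed
  moreover have "inj_on (offset n) (indices n)"
  proof (rule inj_onI)
    fix i j assume ij: "i \<in> indices n" "j \<in> indices n" and eq: "offset n i = offset n j"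
    have zero: "offset n k = 0 \<longleftrightarrow> k = 0" if "k \<in> indices n" for k
      using range(1)[OF that] by (auto simp: offset_def sgn_0_0)
    show "i = j"
    proof (cases "i = 0 \<or> j = 0")
      case True
      thus ?thesis using zero ij eq by metis
    next
      case False
      hence nz: "i \<noteq> 0" "j \<noteq> 0" by simp_all
      have "\<bar>path_offset n \<bar>i\<bar>\<bar> = \<bar>path_offset n \<bar>j\<bar>\<bar>"
        using abs[OF nz(1)] abs[OF nz(2)] eq by metis
      hence ray: "\<bar>i\<bar> = \<bar>j\<bar>"
        by (rule path_offset_abs_inj[OF bounds[OF ij(1) nz(1)] bounds[OF ij(2) nz(2)]])
      have "sgn i * path_offset n \<bar>i\<bar> = sgn j * path_offset n \<bar>i\<bar>"
        using eq unfolding offset_def ray .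
      hence "sgn i = sgn j"
        using range(1)[OF ij(1) nz(1)] by (metis mult_right_cancel)
      thus ?thesis using ray by (metis sgn_mult_abs)
    qed
  qed
  moreover have "finite (indices n)" by (simp add: indices_def)
  ultimately show ?thesis
    unfolding bij_betw_def using endo_inj_surj by blast
qed

lemma bij_betw_label:
  assumes "n \<ge> 2"
  shows "bij_betw (\<lambda>x. nat (2 * int n - 2 + x)) (indices n) {1..4*n-5}"
  by (rule bij_betw_byWitness[where f' = "\<lambda>y. int y - (2 * int n - 2)"])
    (use assms in \<open>auto simp: indices_def\<close>)

theorem theorem7:
  fixes n :: nat
  assumes "n \<ge> 3"
  shows "\<exists>C V V' M M' l. degenerated_magic_polygon n C V V' M M' l"
proof -
  define V where "V = vertex n"
  define V' where "V' = (\<lambda>k. vertex n k / 2)"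
  define M where "M = (\<lambda>j. midpoint (vertex n j) (vertex n (j + 1)))"
  define M' where "M' = (\<lambda>j. midpoint (vertex n j) (vertex n (j + 1)) / 2)"
  define value_of where "value_of = (\<lambda>i. nat (2 * int n - 2 + offset n i))"
  define l where "l = value_of \<circ> inv_into (indices n) (point n)"
  have inj: "inj_on (point n) (indices n)"
    using assms by (intro inj_on_point) simp
  have points: "figure_points n 0 V V' M M' = point n ` indices n"
    unfolding V_def V'_def M_def M'_def by (rule figure_points_vertex[OF assms])
  have "bij_betw value_of (indices n) {1..4*n-5}"
    using bij_betw_trans[OF bij_betw_offset bij_betw_label[of n]] assms
    by (simp add: value_of_def comp_def)
  moreover have "bij_betw (inv_into (indices n) (point n)) (point n ` indices n) (indices n)"
    using inj by (intro bij_betw_inv_into) (simp add: bij_betw_def)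
  ultimately have bij: "bij_betw l (figure_points n 0 V V' M M') {1..4*n-5}"
    unfolding l_def points by (rule bij_betw_trans[rotated])
  have label: "int (l (point n i)) = 2 * int n - 2 + offset n i" if "i \<in> indices n" for i
  proof -
    have "offset n i \<in> indices n"
      using bij_betw_offset that by (rule bij_betwE[THEN bspec])
    thus ?thesis
      using that inj assms by (simp add: l_def value_of_def indices_def)
  qed
  have C: "int (l 0) = 2 * int n - 2"
    using label[of 0] assms by (simp add: indices_def)
  have outer: "int (l (V j)) = 2 * int n - 2 + path_offset n (2 * int j - 1)"
    and inner: "int (l (V' j)) = 2 * int n - 2 - path_offset n (2 * int j - 1)"
    if "j \<in> {1..n-1}" for j
    using that label[of "2 * int j - 1"] label[of "- (2 * int j - 1)"] assms
      offset_simps[of "2 * int j - 1" n] vertex_eq_point(2)[of j n]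
    by (auto simp: V_def V'_def vertex_eq_point(1) indices_def)
  have mid_outer: "int (l (M j)) = 2 * int n - 2 + path_offset n (2 * int j)"
    and mid_inner: "int (l (M' j)) = 2 * int n - 2 - path_offset n (2 * int j)"
    if "j \<in> {1..n-2}" for j
    using that label[of "2 * int j"] label[of "- (2 * int j)"] assms
      offset_simps[of "2 * int j" n] midpoint_eq_point[of j n]
    by (auto simp: M_def M'_def indices_def)
  have edges: "l (V j) + l (M j) + l (V (j + 1)) = 6 * n - 6"
    "l (V' j) + l (M' j) + l (V' (j + 1)) = 6 * n - 6" if "j \<in> {1..n-2}" for j
  proof -
    have "j \<in> {1..n-1}" "j + 1 \<in> {1..n-1}" using that by auto
    note vals = outer[OF this(1)] outer[OF this(2)] inner[OF this(1)] inner[OF this(2)]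
      mid_outer[OF that] mid_inner[OF that]
    have "path_offset n (2 * int j - 1) + path_offset n (2 * int j)
        + path_offset n (2 * int (j + 1) - 1) = 0"
      using path_offset_edge[of n "int j"] by (simp add: add.commute)
    thus "l (V j) + l (M j) + l (V (j + 1)) = 6 * n - 6"
      "l (V' j) + l (M' j) + l (V' (j + 1)) = 6 * n - 6"
      using vals assms by linarith+
  qed
  have vertex_rays: "l (V j) + l (V' j) + l 0 = 6 * n - 6" if "j \<in> {1..n-1}" for j
    using outer[OF that] inner[OF that] C assms by linarith
  have mid_rays: "l (M j) + l (M' j) + l 0 = 6 * n - 6" if "j \<in> {1..n-2}" for j
    using mid_outer[OF that] mid_inner[OF that] C assms by linarith
  have "degenerated_figure n 0 V V' M M'"
    unfolding V_def V'_def M_def M'_def by (rule degenerated_figure_vertex[OF assms])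
  hence "degenerated_magic_polygon n 0 V V' M M' l"
    unfolding degenerated_magic_polygon_def using bij edges vertex_rays mid_rays by blast
  thus ?thesis by blast
qed

end
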